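(* For a book graph $B_n$, $DI(B_n)=2(n^2+2)$.
   Context: A dominating set of a graph $G$ is a set $D\subseteq V(G)$ such that every vertex in $V(G)\setminus D$ is adjacent to some vertex of $D$. A minimal dominating set is a dominating set that does not properly contain any other dominating set. The domination degree of a vertex $a$ is $d_d(a)=\min\{|D| : D \text{ is a minimal dominating set of } G \text{ with } a\in D\}$. The domination index of $G$ is $DI(G)=\sum_{a\in V(G)}d_d(a)$. The book graph $B_n$ is the Cartesian product $S_{n+1}\times P_2$, where $S_{n+1}$ is the star with $n+1$ vertices (a vertex of degree $n$, adjacent to the $n$ remaining vertices, with no other edges) and $P_2$ is the path on two vertices; in the Cartesian product, $(u,v)$ and $(u',v')$ are adjacent iff either $u=u'$ and $v$ is adjacent to $v'$, or $v=v'$ and $u$ is adjacent to $u'$.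
   Formalization: The formula is proved for n ≥ 2; it fails for the smaller values, since B_1 is the 4-cycle with DI = 8 (formula: 6) and B_0 is a single edge with DI = 2 (formula: 4). *)

theory Defs
  imports "Graph_Theory.Pair_Digraph"
begin

text \<open>A finite simple graph is a \<open>pair_graph\<close> of the AFP entry Graph-Theory: a finite loopfree
  digraph whose arc set is symmetric, each edge \<open>{u, v}\<close> being present as both \<open>(u, v)\<close> and
  \<open>(v, u)\<close>. Adjacency is thus \<open>(u, v) \<in> parcs G\<close>.\<close>

definition dominating_set :: "'a pair_pre_digraph \<Rightarrow> 'a set \<Rightarrow> bool" where
  "dominating_set G D \<longleftrightarrow>
     D \<subseteq> pverts G \<and> (\<forall>v \<in> pverts G - D. \<exists>u \<in> D. (v, u) \<in> parcs G)"

definition minimal_dominating_set :: "'a pair_pre_digraph \<Rightarrow> 'a set \<Rightarrow> bool" where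
  "minimal_dominating_set G D \<longleftrightarrow>
     dominating_set G D \<and> \<not> (\<exists>D'. D' \<subset> D \<and> dominating_set G D')"

definition domination_degree :: "'a pair_pre_digraph \<Rightarrow> 'a \<Rightarrow> nat" where
  "domination_degree G a = Min {card D | D. minimal_dominating_set G D \<and> a \<in> D}"

definition domination_index :: "'a pair_pre_digraph \<Rightarrow> nat" where
  "domination_index G = (\<Sum>a \<in> pverts G. domination_degree G a)"

text \<open>The star with \<open>m\<close> vertices, with centre \<open>0\<close> (so the centre has degree \<open>m - 1\<close>), and the path
  on \<open>m\<close> vertices.\<close>

definition star_graph :: "nat \<Rightarrow> nat pair_pre_digraph" where
  "star_graph m = \<lparr> pverts = {..<m},
     parcs = {(i, j). i < m \<and> j < m \<and> i \<noteq> j \<and> (i = 0 \<or> j = 0)} \<rparr>"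

definition path_graph :: "nat \<Rightarrow> nat pair_pre_digraph" where
  "path_graph m = \<lparr> pverts = {..<m},
     parcs = {(i, j). i < m \<and> j < m \<and> (j = Suc i \<or> i = Suc j)} \<rparr>"

definition cartesian_product ::
    "'a pair_pre_digraph \<Rightarrow> 'b pair_pre_digraph \<Rightarrow> ('a \<times> 'b) pair_pre_digraph" where
  "cartesian_product G H = \<lparr> pverts = pverts G \<times> pverts H,
     parcs = {((u, v), (u', v')).
       (u = u' \<and> u \<in> pverts G \<and> (v, v') \<in> parcs H) \<or>
       (v = v' \<and> v \<in> pverts H \<and> (u, u') \<in> parcs G)} \<rparr>"

definition book_graph :: "nat \<Rightarrow> (nat \<times> nat) pair_pre_digraph" where
  "book_graph n = cartesian_product (star_graph (n + 1)) (path_graph 2)"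

lemma pair_graph_star_graph: "pair_graph (star_graph m)"
proof -
  have "finite (parcs (star_graph m))"
    by (rule finite_subset[of _ "{..<m} \<times> {..<m}"]) (auto simp: star_graph_def)
  then show ?thesis
    by unfold_locales (auto simp: star_graph_def symmetric_def sym_def)
qed

lemma pair_graph_path_graph: "pair_graph (path_graph m)"
proof -
  have "finite (parcs (path_graph m))"
    by (rule finite_subset[of _ "{..<m} \<times> {..<m}"]) (auto simp: path_graph_def)
  then show ?thesis
    by unfold_locales (auto simp: path_graph_def symmetric_def sym_def)
qed

lemma pair_graph_cartesian_product:
  assumes "pair_graph G" "pair_graph H"
  shows "pair_graph (cartesian_product G H)"
proof -
  interpret G: pair_graph G by fact
  interpret H: pair_graph H by fact
  let ?V = "pverts G \<times> pverts H"
  have sub: "parcs (cartesian_product G H) \<subseteq> ?V \<times> ?V"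
    by (auto simp: cartesian_product_def dest: G.wellformed' H.wellformed')
  moreover have "finite ?V" by simp
  ultimately have fin: "finite (parcs (cartesian_product G H))"
    by (meson finite_SigmaI finite_subset)
  show ?thesis
  proof unfold_locales
    show "symmetric (with_proj (cartesian_product G H))"
      by (auto simp: cartesian_product_def symmetric_def sym_def
          dest: G.arcs_symmetric H.arcs_symmetric)
  qed (use sub fin in \<open>auto simp: cartesian_product_def dest: G.no_loops' H.no_loops'
        G.wellformed' H.wellformed'\<close>)
qed

lemma pair_graph_book_graph: "pair_graph (book_graph n)"
  unfolding book_graph_def
  by (intro pair_graph_cartesian_product pair_graph_star_graph pair_graph_path_graph)

text \<open>The minimum in \<open>domination_degree\<close> is taken over a finite nonempty set: a maximal
  independent set containing \<open>a\<close> is a minimal dominating set.\<close>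

lemma domination_degree_well_defined:
  assumes "pair_graph G" "a \<in> pverts G"
  shows "finite {card D | D. minimal_dominating_set G D \<and> a \<in> D}"
    and "{card D | D. minimal_dominating_set G D \<and> a \<in> D} \<noteq> {}"
proof -
  interpret pair_graph G by fact
  have "{card D | D. minimal_dominating_set G D \<and> a \<in> D} \<subseteq> card ` Pow (pverts G)"
    by (auto simp: minimal_dominating_set_def dominating_set_def)
  then show "finite {card D | D. minimal_dominating_set G D \<and> a \<in> D}"
    by (rule finite_subset) simp
  define I where
    "I = {S. S \<subseteq> pverts G \<and> a \<in> S \<and> (\<forall>u \<in> S. \<forall>v \<in> S. (u, v) \<notin> parcs G)}"
  have "finite I" by (rule finite_subset[of _ "Pow (pverts G)"]) (auto simp: I_def)
  moreover have "{a} \<in> I" using assms(2) by (auto simp: I_def dest: no_loops')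
  ultimately obtain D where D: "D \<in> I" and max: "\<And>S. S \<in> I \<Longrightarrow> D \<subseteq> S \<Longrightarrow> S = D"
    using finite_has_maximal[of I] by blast
  have "\<exists>u \<in> D. (v, u) \<in> parcs G" if v: "v \<in> pverts G - D" for v
  proof (rule ccontr)
    assume "\<not> ?thesis"
    then have "insert v D \<in> I"
      using D v by (auto simp: I_def dest: no_loops' arcs_symmetric)
    then show False using max[of "insert v D"] v by auto
  qed
  then have "dominating_set G D" using D by (auto simp: dominating_set_def I_def)
  moreover have "\<not> dominating_set G D'" if D': "D' \<subset> D" for D'
  proof
    assume dom: "dominating_set G D'"
    obtain v where "v \<in> D" "v \<notin> D'" using D' by auto
    then show False using dom D D' by (fastforce simp: dominating_set_def I_def)
  qed
  ultimately have "minimal_dominating_set G D" by (auto simp: minimal_dominating_set_def)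
  then show "{card D | D. minimal_dominating_set G D \<and> a \<in> D} \<noteq> {}"
    using D by (auto simp: I_def)
qed

end

theory Submission
  imports Defs
begin

text \<open>
  Write the vertices of the book graph as \<open>(i, b)\<close> with \<open>i \<le> n\<close> and \<open>b < 2\<close>: the two vertices with
  \<open>i = 0\<close> form the spine, and for \<open>1 \<le> i \<le> n\<close> the two vertices \<open>(i, 0)\<close>, \<open>(i, 1)\<close> are the outer
  corners of the \<open>i\<close>-th page. Everything rests on a dichotomy (\<open>spine_or_many\<close>): a dominating set
  contains the whole spine or has at least \<open>n\<close> elements, because a corner on the side of
  a missing spine vertex can only be dominated from its own page, so every page must be hit.

  The spine dominates the graph, hence it is a minimal dominating set of size \<open>2\<close>; by the
  dichotomy and \<open>n \<ge> 2\<close> nothing smaller dominates, so both spine vertices have degree \<open>2\<close>. A minimal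
  dominating set through a corner cannot contain the spine, so it has at least \<open>n\<close> elements. For
  \<open>n \<ge> 2\<close> this value is attained by one corner per page, the chosen corner \<open>(i, b)\<close> lying on one side
  and all the others on the opposite side, so that both spine vertices are dominated. The
  index is therefore \<open>2 \<cdot> 2 + 2n \<cdot> n\<close>.
\<close>

lemma domination_degree_eqI:
  assumes "pair_graph G" "minimal_dominating_set G D" "a \<in> D"
    and least: "\<And>D'. minimal_dominating_set G D' \<Longrightarrow> a \<in> D' \<Longrightarrow> card D \<le> card D'"
  shows "domination_degree G a = card D"
proof -
  have "a \<in> pverts G"
    using assms(2,3) by (auto simp: minimal_dominating_set_def dominating_set_def)
  then have "finite {card D | D. minimal_dominating_set G D \<and> a \<in> D}"
    by (rule domination_degree_well_defined(1)[OF assms(1)])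
  then show ?thesis
    unfolding domination_degree_def using assms(2,3) least by (intro Min_eqI) auto
qed

lemma minimal_dominating_setI_card:
  assumes "finite D" "dominating_set G D"
    and "\<And>D'. D' \<subset> D \<Longrightarrow> dominating_set G D' \<Longrightarrow> card D \<le> card D'"
  shows "minimal_dominating_set G D"
proof -
  have False if "D' \<subset> D" "dominating_set G D'" for D'
    using assms(3)[OF that] psubset_card_mono[OF assms(1) that(1)] by simp
  then show ?thesis using assms(2) by (auto simp: minimal_dominating_set_def)
qed

lemma pverts_book_graph: "pverts (book_graph n) = {..n} \<times> {..<2}"
  by (auto simp: book_graph_def cartesian_product_def star_graph_def path_graph_def)

lemma parcs_book_graph:
  "((i, b), (j, c)) \<in> parcs (book_graph n) \<longleftrightarrow>
     i \<le> n \<and> j \<le> n \<and> b < 2 \<and> c < 2 \<and>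
     (i = j \<and> b \<noteq> c \<or> b = c \<and> i \<noteq> j \<and> (i = 0 \<or> j = 0))"
  by (auto simp: book_graph_def cartesian_product_def star_graph_def path_graph_def)

definition spine :: "(nat \<times> nat) set" where
  "spine = {0} \<times> {..<2}"

lemma card_spine: "card spine = 2"
  by (simp add: spine_def)

lemma dominating_set_spine: "dominating_set (book_graph n) spine"
  by (auto simp: dominating_set_def spine_def pverts_book_graph parcs_book_graph)

lemma finite_dominating_set_book: "dominating_set (book_graph n) D \<Longrightarrow> finite D"
  by (auto simp: dominating_set_def pverts_book_graph intro: finite_subset)

text \<open>If \<open>(0, b)\<close> is missing, the corner \<open>(i, b)\<close> of page \<open>i\<close> has only \<open>(i, 1 - b)\<close> left as a possible
  dominating neighbour, so the first projection of \<open>D\<close> covers all pages.\<close>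

lemma spine_or_many:
  assumes dom: "dominating_set (book_graph n) D"
  shows "spine \<subseteq> D \<or> n \<le> card D"
proof (rule disjCI)
  assume "\<not> n \<le> card D"
  show "spine \<subseteq> D"
  proof (rule ccontr)
    assume "\<not> spine \<subseteq> D"
    then obtain b where b: "b < 2" "(0, b) \<notin> D" by (auto simp: spine_def)
    have "i \<in> fst ` D" if i: "i \<in> {1..n}" for i
    proof (cases "(i, b) \<in> D")
      case True
      then show ?thesis by force
    next
      case False
      then have "(i, b) \<in> pverts (book_graph n) - D"
        using i b by (simp add: pverts_book_graph)
      then obtain j c where "(j, c) \<in> D" "((i, b), (j, c)) \<in> parcs (book_graph n)"
        using dom unfolding dominating_set_def by fast
      then show ?thesis using i b by (force simp: parcs_book_graph)
    qed
    then have "{1..n} \<subseteq> fst ` D" by blast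
    then have "n \<le> card (fst ` D)"
      using card_mono[of "fst ` D" "{1..n}"] finite_dominating_set_book[OF dom] by simp
    also have "\<dots> \<le> card D"
      by (rule card_image_le[OF finite_dominating_set_book[OF dom]])
    finally show False using \<open>\<not> n \<le> card D\<close> by simp
  qed
qed

lemma minimal_dominating_set_spine:
  assumes "n \<ge> 2"
  shows "minimal_dominating_set (book_graph n) spine"
proof (rule minimal_dominating_setI_card)
  fix D' assume "D' \<subset> spine" "dominating_set (book_graph n) D'"
  then show "card spine \<le> card D'"
    using spine_or_many[of n D'] assms by (auto simp: card_spine)
qed (simp_all add: dominating_set_spine, simp add: spine_def)

lemma domination_degree_spine:
  assumes "n \<ge> 2" "a \<in> spine"
  shows "domination_degree (book_graph n) a = 2"
proof -
  have "card spine \<le> card D" if "minimal_dominating_set (book_graph n) D" for D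
  proof -
    have dom: "dominating_set (book_graph n) D"
      using that by (simp add: minimal_dominating_set_def)
    from spine_or_many[OF dom] show ?thesis
      using assms(1) card_mono[OF finite_dominating_set_book[OF dom], of spine]
      by (auto simp: card_spine)
  qed
  then show ?thesis
    using domination_degree_eqI[OF pair_graph_book_graph minimal_dominating_set_spine] assms
    by (simp add: card_spine)
qed

definition corner_transversal :: "nat \<Rightarrow> nat \<Rightarrow> nat \<Rightarrow> (nat \<times> nat) set" where
  "corner_transversal n i b = (\<lambda>j. (j, if j = i then b else 1 - b)) ` {1..n}"

lemma card_corner_transversal: "card (corner_transversal n i b) = n"
  unfolding corner_transversal_def by (subst card_image) (auto intro: inj_onI)

text \<open>The opposite corner of every page is dominated within the page. The spine vertex \<open>(0, b)\<close> is
  dominated by \<open>(i, b)\<close>, and \<open>(0, 1 - b)\<close> by the corner of any other page: this is where a second page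
  is needed.\<close>

lemma dominating_set_corner_transversal:
  assumes "n \<ge> 2" "i \<in> {1..n}" "b < 2"
  shows "dominating_set (book_graph n) (corner_transversal n i b)"
proof -
  obtain k where k: "k \<in> {1..n}" "k \<noteq> i"
  proof
    show "(if i = 1 then 2 else 1) \<in> {1..n}" "(if i = 1 then 2 else 1) \<noteq> i"
      using assms by auto
  qed
  let ?T = "corner_transversal n i b"
  have T: "(j, if j = i then b else 1 - b) \<in> ?T" if "j \<in> {1..n}" for j
    using that by (auto simp: corner_transversal_def)
  have "\<exists>u \<in> ?T. ((j, c), u) \<in> parcs (book_graph n)"
    if v: "j \<le> n" "c < 2" "(j, c) \<notin> ?T" for j c
  proof (cases "j = 0")
    case True
    show ?thesis
    proof (cases "c = b")
      case True
      with T[of i] assms v \<open>j = 0\<close> show ?thesis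
        by (intro bexI[of _ "(i, b)"]) (auto simp: parcs_book_graph)
    next
      case False
      with T[of k] k assms v \<open>j = 0\<close> show ?thesis
        by (intro bexI[of _ "(k, 1 - b)"]) (auto simp: parcs_book_graph)
    qed
  next
    case False
    with T[of j] v assms(3) show ?thesis
      by (intro bexI[of _ "(j, if j = i then b else 1 - b)"]) (auto simp: parcs_book_graph)
  qed
  moreover have "?T \<subseteq> pverts (book_graph n)"
    using assms(3) by (auto simp: corner_transversal_def pverts_book_graph)
  ultimately show ?thesis
    by (auto simp: dominating_set_def pverts_book_graph)
qed

lemma minimal_dominating_set_corner_transversal:
  assumes "n \<ge> 2" "i \<in> {1..n}" "b < 2"
  shows "minimal_dominating_set (book_graph n) (corner_transversal n i b)"
proof (rule minimal_dominating_setI_card)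
  show "finite (corner_transversal n i b)" by (simp add: corner_transversal_def)
  show "dominating_set (book_graph n) (corner_transversal n i b)"
    by (rule dominating_set_corner_transversal[OF assms])
  fix D' assume sub: "D' \<subset> corner_transversal n i b" and dom: "dominating_set (book_graph n) D'"
  have "(0, 0) \<notin> D'" using sub by (auto simp: corner_transversal_def)
  moreover have "(0, 0) \<in> spine" by (simp add: spine_def)
  ultimately have "\<not> spine \<subseteq> D'" by blast
  then show "card (corner_transversal n i b) \<le> card D'"
    using spine_or_many[OF dom] by (simp add: card_corner_transversal)
qed

lemma domination_degree_corner:
  assumes "n \<ge> 2" "i \<in> {1..n}" "b < 2"
  shows "domination_degree (book_graph n) (i, b) = n"
proof -
  have "n \<le> card D" if D: "minimal_dominating_set (book_graph n) D" "(i, b) \<in> D" for D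
  proof -
    have "(i, b) \<notin> spine" using assms(2) by (simp add: spine_def)
    \<comment> \<open>A set containing the spine and this corner properly contains a dominating set.\<close>
    then have "\<not> spine \<subseteq> D"
      using D dominating_set_spine[of n] unfolding minimal_dominating_set_def by blast
    then show ?thesis
      using D(1) spine_or_many by (auto simp: minimal_dominating_set_def)
  qed
  moreover have "(i, b) \<in> corner_transversal n i b"
    using assms(2) by (auto simp: corner_transversal_def)
  ultimately show ?thesis
    using domination_degree_eqI[OF pair_graph_book_graph
        minimal_dominating_set_corner_transversal[OF assms]]
    by (simp add: card_corner_transversal)
qed

theorem proposition4p13:
  fixes n :: nat
  assumes "n \<ge> 2"
  shows "domination_index (book_graph n) = 2 * (n ^ 2 + 2)"
proof -
  let ?d = "domination_degree (book_graph n)"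
  let ?corners = "{1..n} \<times> {..<2::nat}"
  have split: "pverts (book_graph n) = spine \<union> ?corners"
    by (auto simp: pverts_book_graph spine_def)
  have "domination_index (book_graph n) = sum ?d spine + sum ?d ?corners"
    unfolding domination_index_def split
    by (rule sum.union_disjoint) (auto simp: spine_def)
  also have "sum ?d spine = (\<Sum>a\<in>spine. 2)"
    using assms by (intro sum.cong) (simp_all add: domination_degree_spine)
  also have "sum ?d ?corners = (\<Sum>a\<in>?corners. n)"
    using assms by (intro sum.cong) (auto simp: domination_degree_corner)
  finally show ?thesis
    by (simp add: card_spine power2_eq_square)
qed

end
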